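(* There is a symmetric competition game with $3$ firms over a synergy graph (i.e. all three firms have the value function $v_M$ for a common synergy graph $M$) that has no PSPE.
   Context: Competition game: $N$ is a finite set of workers, $K$ a finite set of $k\ge 2$ firms, and each firm $i\in K$ has a nondecreasing value function $v_i:2^N\to\mathbb R_+$ with $v_i(\emptyset)=0$. In step 1 all firms simultaneously choose payment policies $\mathbf x_i=(x_{ij})_{j\in N}\in\mathbb R^N$ (payments may be negative). In step 2 each worker chooses a firm or stays idle. An outcome is a pair $(P,\mathbf X)$ where $\mathbf X=(x_{ij})$ and $P=(S_0,(S_i)_{i\in K})$ is a partition of $N$ ($S_0$ = idle workers; parts may be empty). Put $x_{0j}=0$. A worker $j\in S_i$ receives $\hat x_j=x_{ij}$; firm $i$ has profit $r_i(P,\mathbf X)=v_i(S_i)-\sum_{j\in S_i}x_{ij}$. The game is symmetric if all $v_i$ are equal. PSPE: let $\mathcal P(\mathbf X)$ be the set of partitions such that every worker $j\in S_i$ ($i\in K\cup\{0\}$) satisfies $x_{ij}=\max_{i'\in K\cup\{0\}}x_{i'j}$. A tie-breaking rule is a map $\mathbf X\mapsto P(\mathbf X)\in\mathcal P(\mathbf X)$. An outcome $(P,\mathbf X)$ is a pure subgame perfect equilibrium (PSPE) if for some tie-breaking rule: (a) $P=P(\mathbf X)$; and (b) for every $i\in K$ and every policy $\mathbf x_i'$, $r_i(P',\mathbf X')\le r_i(P,\mathbf X)$, where $\mathbf X'=(\mathbf x_{-i},\mathbf x_i')$ and $P'=P(\mathbf X')$. Synergy graph: an undirected graph on $N$ with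 nonnegative edge weights, self-edges allowed, represented by a symmetric nonnegative matrix $M$ indexed by $N\times N$. Its value function is (for a fixed linear order on $N$) $$v_M(S)=\sum_{j\in S}M(j,j)+\sum_{j,j'\in S,\ j<j'}M(j,j')+\sum_{j\in S}\sum_{j''\notin S}M(j,j'').$$ *)

theory Defs
  imports Complex_Main "HOL-Library.FuncSet" "HOL-Library.Disjoint_Sets"
begin

definition competition_game ::
  "'w set \<Rightarrow> 'f set \<Rightarrow> ('f \<Rightarrow> 'w set \<Rightarrow> real) \<Rightarrow> bool" where
  "competition_game N K v \<longleftrightarrow>
     finite N \<and> finite K \<and> card K \<ge> 2 \<and>
     (\<forall>i\<in>K. v i {} = 0 \<and>
        (\<forall>S. S \<subseteq> N \<longrightarrow> 0 \<le> v i S) \<and>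
        (\<forall>S T. S \<subseteq> T \<and> T \<subseteq> N \<longrightarrow> v i S \<le> v i T))"

definition symmetric_game ::
  "'w set \<Rightarrow> 'f set \<Rightarrow> ('f \<Rightarrow> 'w set \<Rightarrow> real) \<Rightarrow> bool" where
  "symmetric_game N K v \<longleftrightarrow> (\<forall>i\<in>K. \<forall>i'\<in>K. \<forall>S. S \<subseteq> N \<longrightarrow> v i S = v i' S)"

text \<open>
  The options open to a worker are the firms \<open>Some i\<close> and staying idle, \<open>None\<close>
  (the index 0 of the mathematical notation).  Policies and partitions are extensional functions,
  so that a tie-breaking rule, which is a function of the payment matrix, sees nothing but the
  payments of firms in \<open>K\<close> to workers in \<open>N\<close>.
\<close>

definition choices :: "'f set \<Rightarrow> 'f option set" where
  "choices K = insert None (Some ` K)"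

definition policies :: "'w set \<Rightarrow> ('w \<Rightarrow> real) set" where
  "policies N = N \<rightarrow>\<^sub>E UNIV"

definition profiles :: "'w set \<Rightarrow> 'f set \<Rightarrow> ('f \<Rightarrow> 'w \<Rightarrow> real) set" where
  "profiles N K = K \<rightarrow>\<^sub>E policies N"

definition partitions :: "'w set \<Rightarrow> 'f set \<Rightarrow> ('f option \<Rightarrow> 'w set) set" where
  "partitions N K =
     {P \<in> choices K \<rightarrow>\<^sub>E Pow N. (\<Union>c\<in>choices K. P c) = N \<and> disjoint_family_on P (choices K)}"

fun payment :: "('f \<Rightarrow> 'w \<Rightarrow> real) \<Rightarrow> 'f option \<Rightarrow> 'w \<Rightarrow> real" where
  "payment X None j = 0"
| "payment X (Some i) j = X i j"

definition profit ::
  "('f \<Rightarrow> 'w set \<Rightarrow> real) \<Rightarrow> ('f option \<Rightarrow> 'w set) \<Rightarrow> ('f \<Rightarrow> 'w \<Rightarrow> real) \<Rightarrow> 'f \<Rightarrow> real" where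
  "profit v P X i = v i (P (Some i)) - (\<Sum>j\<in>P (Some i). X i j)"

definition optimal_partitions ::
  "'w set \<Rightarrow> 'f set \<Rightarrow> ('f \<Rightarrow> 'w \<Rightarrow> real) \<Rightarrow> ('f option \<Rightarrow> 'w set) set" where
  "optimal_partitions N K X =
     {P \<in> partitions N K.
        \<forall>c\<in>choices K. \<forall>j\<in>P c. payment X c j = Max ((\<lambda>c'. payment X c' j) ` choices K)}"

definition tie_breaking_rule ::
  "'w set \<Rightarrow> 'f set \<Rightarrow> (('f \<Rightarrow> 'w \<Rightarrow> real) \<Rightarrow> 'f option \<Rightarrow> 'w set) \<Rightarrow> bool" where
  "tie_breaking_rule N K R \<longleftrightarrow> (\<forall>X\<in>profiles N K. R X \<in> optimal_partitions N K X)"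

definition is_PSPE ::
  "'w set \<Rightarrow> 'f set \<Rightarrow> ('f \<Rightarrow> 'w set \<Rightarrow> real) \<Rightarrow>
     ('f option \<Rightarrow> 'w set) \<Rightarrow> ('f \<Rightarrow> 'w \<Rightarrow> real) \<Rightarrow> bool" where
  "is_PSPE N K v P X \<longleftrightarrow>
     P \<in> partitions N K \<and> X \<in> profiles N K \<and>
     (\<exists>R. tie_breaking_rule N K R \<and> P = R X \<and>
        (\<forall>i\<in>K. \<forall>x'\<in>policies N.
           profit v (R (X(i := x'))) (X(i := x')) i \<le> profit v P X i))"

definition synergy_graph :: "'w set \<Rightarrow> ('w \<Rightarrow> 'w \<Rightarrow> real) \<Rightarrow> bool" where
  "synergy_graph N M \<longleftrightarrow> (\<forall>j\<in>N. \<forall>j'\<in>N. 0 \<le> M j j' \<and> M j j' = M j' j)"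

definition synergy_value ::
  "'w::linorder set \<Rightarrow> ('w \<Rightarrow> 'w \<Rightarrow> real) \<Rightarrow> 'w set \<Rightarrow> real" where
  "synergy_value N M S =
     (\<Sum>j\<in>S. M j j)
     + (\<Sum>(j, j')\<in>{(j, j'). j \<in> S \<and> j' \<in> S \<and> j < j'}. M j j')
     + (\<Sum>j\<in>S. \<Sum>j''\<in>N - S. M j j'')"

end

(*
  Overbidding the highest offers p by an arbitrarily small amount hires any desired set of workers,
  whatever the tie-breaking rule, so a PSPE is a Walrasian equilibrium with prices p.
  An edge is worth its weight to each firm that employs an end of it, so the total profit is the sum
  of the weighted degrees minus p over the employed workers, less the weight of the edges inside the
  firms.  If the graph admits a fractional colouring of total weight at most |K|, then averaging the
  equilibrium conditions over its independent sets shows that no edge lies inside a firm and that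
  idle workers are isolated, so the graph is |K|-colourable.  The Groetzsch graph has fractional
  chromatic number 29/10 but is not 3-colourable.
*)
theory Submission
  imports Defs
begin

section \<open>Equilibria and Walrasian prices\<close>

lemma payment_le_Max:
  assumes "finite K" "c \<in> choices K"
  shows "payment X c j \<le> Max ((\<lambda>c. payment X c j) ` choices K)"
  using assms by (intro Max_ge) (auto simp: choices_def)

text \<open>The price of a worker is the best option open to that worker, staying idle included.
  Each firm thus pays its own workers exactly \<open>p\<close>, and the limit of ever smaller
  overbids gives the inequality for every \<open>T\<close>.\<close>

lemma PSPE_imp_walrasian:
  fixes v :: "'f \<Rightarrow> 'w set \<Rightarrow> real"
  assumes fin: "finite N" "finite K" and eq: "is_PSPE N K v P X"
  obtains p where "\<And>j. j \<in> P None \<Longrightarrow> p j = 0"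
    and "\<And>i T. i \<in> K \<Longrightarrow> T \<subseteq> N \<Longrightarrow>
           v i T - (\<Sum>j\<in>T. p j) \<le> v i (P (Some i)) - (\<Sum>j\<in>P (Some i). p j)"
proof -
  define p where "p j = Max ((\<lambda>c. payment X c j) ` choices K)" for j
  obtain R where X: "X \<in> profiles N K" and R: "tie_breaking_rule N K R" and P: "P = R X"
    and best: "\<And>i x'. i \<in> K \<Longrightarrow> x' \<in> policies N \<Longrightarrow>
           profit v (R (X(i := x'))) (X(i := x')) i \<le> profit v P X i"
    using eq unfolding is_PSPE_def by blast
  have opt: "P \<in> optimal_partitions N K X"
    using X R P unfolding tie_breaking_rule_def by blast
  have pay: "payment X c j = p j" if "c \<in> choices K" "j \<in> P c" for c j
    using opt that unfolding optimal_partitions_def p_def by blast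
  have idle: "p j = 0" if "j \<in> P None" for j
    using pay[of None j] that by (simp add: choices_def)
  have p_ge: "payment X c j \<le> p j" if "c \<in> choices K" for c j
    using payment_le_Max[OF fin(2) that] by (simp add: p_def)
  have "v i T - (\<Sum>j\<in>T. p j) \<le> v i (P (Some i)) - (\<Sum>j\<in>P (Some i). p j)"
    if i: "i \<in> K" and T: "T \<subseteq> N" for i T
  proof -
    have now: "profit v P X i = v i (P (Some i)) - (\<Sum>j\<in>P (Some i). p j)"
      unfolding profit_def using pay[of "Some i"] i by (auto simp: choices_def intro!: sum.cong)
    have finT: "finite T"
      using T fin(1) finite_subset by blast
    have deviate: "v i T - (\<Sum>j\<in>T. p j) - e * card T \<le> profit v P X i" if "e > 0" for e :: real
    proof -
      \<comment> \<open>The offer \<open>p j + e\<close> strictly beats every rival offer and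
        idleness, while -1 is worse than idleness. All ties that involve firm \<open>i\<close> are
        avoided, so the rule \<open>R\<close> has no say in whom it hires.\<close>
      define x where "x = (\<lambda>j\<in>N. if j \<in> T then p j + e else -1)"
      define Y where "Y = X(i := x)"
      have x: "x \<in> policies N"
        by (simp add: x_def policies_def)
      have "Y \<in> profiles N K"
        using PiE_fun_upd[of x "\<lambda>_. policies N" i X K] X x i
        by (simp add: profiles_def Y_def insert_absorb)
      hence RY: "R Y \<in> optimal_partitions N K Y"
        using R unfolding tie_breaking_rule_def by blast
      hence part: "R Y \<in> partitions N K"
        unfolding optimal_partitions_def by blast
      have top: "payment Y c' j \<le> payment Y c j"
        if "c \<in> choices K" "j \<in> R Y c" "c' \<in> choices K" for c c' j
        using RY that payment_le_Max[OF fin(2) that(3), of Y j]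
        unfolding optimal_partitions_def by auto
      have Si: "Some i \<in> choices K" and None: "None \<in> choices K"
        using i by (auto simp: choices_def)
      have sub: "R Y c \<subseteq> N" if "c \<in> choices K" for c
        using part that unfolding partitions_def by auto
      have "R Y (Some i) = T"
      proof
        show "R Y (Some i) \<subseteq> T"
        proof
          fix j assume j: "j \<in> R Y (Some i)"
          hence "j \<in> N" using sub[OF Si] by blast
          thus "j \<in> T"
            using top[OF Si j None] by (auto simp: Y_def x_def split: if_splits)
        qed
        show "T \<subseteq> R Y (Some i)"
        proof
          fix j assume j: "j \<in> T"
          obtain c where c: "c \<in> choices K" "j \<in> R Y c"
            using part j T unfolding partitions_def by blast
          have "c = Some i"
          proof (rule ccontr)
            assume "c \<noteq> Some i"
            hence "payment Y c j = payment X c j"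
              by (cases c) (auto simp: Y_def)
            moreover have "payment Y (Some i) j = p j + e"
              using j T by (auto simp: Y_def x_def)
            ultimately show False
              using top[OF c Si] p_ge[OF c(1), of j] \<open>e > 0\<close> by simp
          qed
          thus "j \<in> R Y (Some i)" using c by simp
        qed
      qed
      moreover have "(\<Sum>j\<in>T. Y i j) = (\<Sum>j\<in>T. p j) + e * card T"
      proof -
        have "(\<Sum>j\<in>T. Y i j) = (\<Sum>j\<in>T. p j + e)"
          using T by (intro sum.cong) (auto simp: Y_def x_def)
        thus ?thesis by (simp add: sum.distrib)
      qed
      ultimately have "profit v (R Y) Y i = v i T - (\<Sum>j\<in>T. p j) - e * card T"
        by (simp add: profit_def)
      thus ?thesis
        using best[OF i x] by (simp add: Y_def)
    qed
    have "v i T - (\<Sum>j\<in>T. p j) \<le> profit v P X i"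
    proof (rule field_le_epsilon)
      fix e :: real assume "e > 0"
      \<comment> \<open>The overbid costs its amount once per worker of \<open>T\<close>; the
        summand 1 covers empty \<open>T\<close>.\<close>
      have "e / (1 + card T) * card T \<le> e"
        using \<open>e > 0\<close> by (simp add: field_simps)
      moreover have "e / (1 + card T) > 0"
        using \<open>e > 0\<close> by (simp add: add_pos_nonneg)
      ultimately show "v i T - (\<Sum>j\<in>T. p j) \<le> profit v P X i + e"
        using deviate[of "e / (1 + card T)"] by linarith
    qed
    thus ?thesis by (simp add: now)
  qed
  thus ?thesis using idle that by blast
qed

section \<open>Synergy values: degrees, internal edges, monotonicity\<close>

definition internal_weight :: "('w::linorder \<Rightarrow> 'w \<Rightarrow> real) \<Rightarrow> 'w set \<Rightarrow> real" where
  "internal_weight M S = (\<Sum>(j, j')\<in>{(j, j'). j \<in> S \<and> j' \<in> S \<and> j < j'}. M j j')"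

text \<open>Self-edges are exempt: they constrain no colouring and \<open>internal_weight\<close>
  omits them.\<close>

definition independent_in :: "('w \<Rightarrow> 'w \<Rightarrow> real) \<Rightarrow> 'w set \<Rightarrow> bool" where
  "independent_in M S \<longleftrightarrow> (\<forall>j\<in>S. \<forall>j'\<in>S. j \<noteq> j' \<longrightarrow> M j j' = 0)"

lemma finite_ordered_pairs:
  assumes "finite S"
  shows "finite {(j, j'). j \<in> S \<and> j' \<in> S \<and> j < j'}"
  by (rule finite_subset[of _ "S \<times> S"]) (use assms in auto)

lemma internal_weight_nonneg:
  assumes "synergy_graph N M" "S \<subseteq> N"
  shows "0 \<le> internal_weight M S"
  unfolding internal_weight_def using assms
  by (intro sum_nonneg) (auto simp: synergy_graph_def)

lemma internal_weight_eq_0_iff: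
  assumes "synergy_graph N M" "S \<subseteq> N" "finite N"
  shows "internal_weight M S = 0 \<longleftrightarrow> independent_in M S"
proof -
  have "finite S" using assms finite_subset by blast
  hence "internal_weight M S = 0 \<longleftrightarrow>
      (\<forall>(j, j')\<in>{(j, j'). j \<in> S \<and> j' \<in> S \<and> j < j'}. M j j' = 0)"
    unfolding internal_weight_def using assms
    by (subst sum_nonneg_eq_0_iff) (auto simp: finite_ordered_pairs synergy_graph_def)
  also have "\<dots> \<longleftrightarrow> (\<forall>j\<in>S. \<forall>j'\<in>S. j < j' \<longrightarrow> M j j' = 0)"
    by auto
  also have "\<dots> \<longleftrightarrow> independent_in M S"
    unfolding independent_in_def using assms(1,2)
    by (metis less_imp_neq linorder_neqE subsetD synergy_graph_def)
  finally show ?thesis .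
qed

text \<open>The degree sum counts an edge inside \<open>S\<close> from both ends, the value only
  once; self-edges and edges leaving \<open>S\<close> are counted once by both.\<close>

lemma synergy_value_eq_degrees:
  assumes M: "synergy_graph N M" and N: "finite N" and S: "S \<subseteq> N"
  shows "synergy_value N M S = (\<Sum>j\<in>S. \<Sum>j'\<in>N. M j j') - internal_weight M S"
proof -
  have fin: "finite S" using N S finite_subset by blast
  let ?L = "{(j, j'). j \<in> S \<and> j' \<in> S \<and> j < j'}"
  let ?G = "{(j, j'). j \<in> S \<and> j' \<in> S \<and> j' < j}"
  let ?D = "(\<lambda>j. (j, j)) ` S"
  have finG: "finite ?G" "finite ?L" "finite ?D"
    by (rule finite_subset[of _ "S \<times> S"]; use fin in auto)+
  have G: "(\<Sum>(j, j')\<in>?G. M j j') = internal_weight M S"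
    unfolding internal_weight_def
    by (rule sum.reindex_bij_witness[of _ "\<lambda>(a, b). (b, a)" "\<lambda>(a, b). (b, a)"])
       (use M S in \<open>auto simp: synergy_graph_def\<close>)
  have D: "(\<Sum>(j, j')\<in>?D. M j j') = (\<Sum>j\<in>S. M j j)"
    by (subst sum.reindex) (auto simp: inj_on_def)
  have "(\<Sum>j\<in>S. \<Sum>j'\<in>S. M j j') = (\<Sum>(j, j')\<in>S \<times> S. M j j')"
    by (rule sum.cartesian_product)
  also have "S \<times> S = ?L \<union> (?G \<union> ?D)"
    by auto
  also have "(\<Sum>(j, j')\<in>?L \<union> (?G \<union> ?D). M j j') =
      (\<Sum>(j, j')\<in>?L. M j j') + ((\<Sum>(j, j')\<in>?G. M j j') + (\<Sum>(j, j')\<in>?D. M j j'))"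
    by (subst sum.union_disjoint, use finG in blast, use finG in blast, force)
       (subst sum.union_disjoint, use finG in blast, use finG in blast, force, simp)
  finally have "(\<Sum>j\<in>S. \<Sum>j'\<in>S. M j j') = 2 * internal_weight M S + (\<Sum>j\<in>S. M j j)"
    by (simp add: G D internal_weight_def)
  moreover have "(\<Sum>j\<in>S. \<Sum>j'\<in>N. M j j') =
      (\<Sum>j\<in>S. \<Sum>j'\<in>N - S. M j j') + (\<Sum>j\<in>S. \<Sum>j'\<in>S. M j j')"
    by (simp add: sum.subset_diff[OF S N] sum.distrib)
  ultimately show ?thesis
    by (simp add: synergy_value_def internal_weight_def)
qed

text \<open>The last sum of the value loses terms as \<open>S\<close> grows, so monotonicity is
  proved from another form: the weight of all edges with at least one end in
  \<open>S\<close>.\<close>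

lemma synergy_competition_game:
  fixes N :: "'w::linorder set" and K :: "'f set"
  assumes M: "synergy_graph N M" and N: "finite N" and "finite K" "card K \<ge> 2"
  shows "competition_game N K (\<lambda>_. synergy_value N M)"
proof -
  have mono: "synergy_value N M S \<le> synergy_value N M T" if "S \<subseteq> T" "T \<subseteq> N" for S T
  proof -
    have fin: "finite T" using that N finite_subset by blast
    let ?L = "\<lambda>S. {(j, j'). j \<in> S \<and> j' \<in> S \<and> j < j'}"
    have M0: "0 \<le> M j j'" if "j \<in> N" "j' \<in> N" for j j'
      using M that by (simp add: synergy_graph_def)
    let ?out = "\<lambda>S. {(j, j'). j \<in> S \<and> j' \<in> N - S}"
    let ?edges = "\<lambda>S. {(j, j'). j \<in> N \<and> j' \<in> N \<and> j < j' \<and> (j \<in> S \<or> j' \<in> S)}"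
    have form: "synergy_value N M S = (\<Sum>j\<in>S. M j j) + (\<Sum>(j, j')\<in>?edges S. M j j')"
      if S: "S \<subseteq> N" for S
    proof -
      have finS: "finite S" using S N finite_subset by blast
      have fins: "finite (?L S)" "finite {(j, j'). j \<in> S \<and> j' \<in> N - S \<and> j < j'}"
        "finite {(j, j'). j' \<in> S \<and> j \<in> N - S \<and> j < j'}"
        "finite {(j, j'). j \<in> S \<and> j' \<in> N - S \<and> j' < j}"
        by (rule finite_subset[of _ "N \<times> N"]; use N S in auto)+
      have "(\<Sum>j\<in>S. \<Sum>j'\<in>N - S. M j j') = (\<Sum>(j, j')\<in>S \<times> (N - S). M j j')"
        by (rule sum.cartesian_product)
      \<comment> \<open>Edges leaving \<open>S\<close> are sorted by which end is smaller; those
        with the smaller end outside are then flipped, to match the increasing pairs of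
        \<open>?edges\<close>.\<close>
      also have "S \<times> (N - S) = {(j, j'). j \<in> S \<and> j' \<in> N - S \<and> j < j'} \<union>
          {(j, j'). j \<in> S \<and> j' \<in> N - S \<and> j' < j}"
        by auto (metis linorder_neqE)
      also have "(\<Sum>(j, j')\<in>\<dots>. M j j') =
          (\<Sum>(j, j')\<in>{(j, j'). j \<in> S \<and> j' \<in> N - S \<and> j < j'}. M j j') +
          (\<Sum>(j, j')\<in>{(j, j'). j \<in> S \<and> j' \<in> N - S \<and> j' < j}. M j j')"
        by (rule sum.union_disjoint) (use fins in auto)
      also have "(\<Sum>(j, j')\<in>{(j, j'). j \<in> S \<and> j' \<in> N - S \<and> j' < j}. M j j') =
          (\<Sum>(j, j')\<in>{(j, j'). j' \<in> S \<and> j \<in> N - S \<and> j < j'}. M j j')"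
        by (rule sum.reindex_bij_witness[of _ "\<lambda>(a, b). (b, a)" "\<lambda>(a, b). (b, a)"])
           (use M S in \<open>auto simp: synergy_graph_def\<close>)
      finally have out: "(\<Sum>j\<in>S. \<Sum>j'\<in>N - S. M j j') =
          (\<Sum>(j, j')\<in>{(j, j'). j \<in> S \<and> j' \<in> N - S \<and> j < j'}. M j j') +
          (\<Sum>(j, j')\<in>{(j, j'). j' \<in> S \<and> j \<in> N - S \<and> j < j'}. M j j')" .
      have "?edges S = ?L S \<union> ({(j, j'). j \<in> S \<and> j' \<in> N - S \<and> j < j'} \<union>
          {(j, j'). j' \<in> S \<and> j \<in> N - S \<and> j < j'})"
        using S by auto
      hence "(\<Sum>(j, j')\<in>?edges S. M j j') = (\<Sum>(j, j')\<in>?L S. M j j') +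
          (\<Sum>(j, j')\<in>{(j, j'). j \<in> S \<and> j' \<in> N - S \<and> j < j'} \<union>
          {(j, j'). j' \<in> S \<and> j \<in> N - S \<and> j < j'}. M j j')"
        using fins by (simp only:) (rule sum.union_disjoint, auto)
      also have "(\<Sum>(j, j')\<in>{(j, j'). j \<in> S \<and> j' \<in> N - S \<and> j < j'} \<union>
          {(j, j'). j' \<in> S \<and> j \<in> N - S \<and> j < j'}. M j j') =
          (\<Sum>j\<in>S. \<Sum>j'\<in>N - S. M j j')"
        unfolding out by (rule sum.union_disjoint) (use fins in auto)
      finally show ?thesis by (simp add: synergy_value_def)
    qed
    have "(\<Sum>j\<in>S. M j j) \<le> (\<Sum>j\<in>T. M j j)"
      using that fin M0 by (intro sum_mono2) auto
    moreover have "(\<Sum>(j, j')\<in>?edges S. M j j') \<le> (\<Sum>(j, j')\<in>?edges T. M j j')"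
    proof (rule sum_mono2)
      show "finite (?edges T)"
        by (rule finite_subset[of _ "N \<times> N"]) (use N in auto)
    qed (use that M0 in auto)
    ultimately show ?thesis using form that by (simp add: order_trans)
  qed
  have "synergy_value N M {} = 0"
    by (simp add: synergy_value_def)
  thus ?thesis
    using assms mono[of "{}"] mono unfolding competition_game_def by auto
qed

section \<open>From an equilibrium and a fractional colouring to a proper colouring\<close>

theorem PSPE_imp_colouring:
  fixes N :: "'w::linorder set" and K :: "'f set" and A :: "'i \<Rightarrow> 'w set"
  assumes fin: "finite N" "finite K" "finite I" and "K \<noteq> {}"
    and M: "synergy_graph N M"
    and A: "\<And>a. a \<in> I \<Longrightarrow> A a \<subseteq> N \<and> independent_in M (A a)"
    and l0: "\<And>a. a \<in> I \<Longrightarrow> 0 \<le> l a"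
    and l: "\<And>j. j \<in> N \<Longrightarrow> (\<Sum>a\<in>I. of_bool (j \<in> A a) * l a) = (1::real)"
    and total: "(\<Sum>a\<in>I. l a) \<le> card K"
    and eq: "is_PSPE N K (\<lambda>_. synergy_value N M) P X"
  obtains c where "c ` N \<subseteq> K"
    and "\<And>j j'. j \<in> N \<Longrightarrow> j' \<in> N \<Longrightarrow> j \<noteq> j' \<Longrightarrow> M j j' \<noteq> 0 \<Longrightarrow> c j \<noteq> c j'"
proof -
  let ?d = "\<lambda>j. \<Sum>j'\<in>N. M j j'"
  obtain p where p0: "\<And>j. j \<in> P None \<Longrightarrow> p j = 0"
    and W: "\<And>i T. i \<in> K \<Longrightarrow> T \<subseteq> N \<Longrightarrow> synergy_value N M T - (\<Sum>j\<in>T. p j)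
           \<le> synergy_value N M (P (Some i)) - (\<Sum>j\<in>P (Some i). p j)"
    using PSPE_imp_walrasian[OF fin(1,2) eq] by metis
  \<comment> \<open>\<open>q j\<close> is the net gain from \<open>j\<close> when no colleague is a
    neighbour; \<open>u i\<close> is the equilibrium profit of firm \<open>i\<close> in these
    terms.\<close>
  define q where "q j = ?d j - p j" for j
  define u where "u i = (\<Sum>j\<in>P (Some i). q j) - internal_weight M (P (Some i))" for i
  have part: "P \<in> partitions N K"
    using eq unfolding is_PSPE_def by blast
  have sub: "P c \<subseteq> N" if "c \<in> choices K" for c
    using part that unfolding partitions_def by auto
  hence finP: "finite (P c)" if "c \<in> choices K" for c
    using that fin(1) finite_subset by blast
  have Some_in: "Some i \<in> choices K" if "i \<in> K" for i
    using that by (simp add: choices_def)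
  have None_in: "None \<in> choices K"
    by (simp add: choices_def)
  have surplus: "synergy_value N M T - (\<Sum>j\<in>T. p j) = (\<Sum>j\<in>T. q j) - internal_weight M T"
    if "T \<subseteq> N" for T
    unfolding synergy_value_eq_degrees[OF M fin(1) that] q_def by (simp add: sum_subtractf)
  have u: "(\<Sum>j\<in>T. q j) - internal_weight M T \<le> u i" if "i \<in> K" "T \<subseteq> N" for i T
    using W[OF that] surplus[OF that(2)] surplus[OF sub[OF Some_in[OF that(1)]]]
    by (simp add: u_def)
  have u0: "0 \<le> u i" if "i \<in> K" for i
    using u[OF that, of "{}"] by (simp add: internal_weight_def)
  \<comment> \<open>The weights at each worker add up to 1, so the left side is a weighted sum of
    deviation profits from independent sets, each at most \<open>u i\<close>. Their total weight can
    be raised to \<open>card K\<close> because \<open>u i\<close> is nonnegative.\<close>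
  have average: "(\<Sum>j\<in>N. q j) \<le> card K * u i" if i: "i \<in> K" for i
  proof -
    have restrict: "(\<Sum>j\<in>A a. q j) = (\<Sum>j\<in>N. of_bool (j \<in> A a) * q j)" if "a \<in> I" for a
      using A[OF that] fin(1)
      by (intro sum.mono_neutral_cong_left) auto
    have "(\<Sum>j\<in>N. q j) = (\<Sum>j\<in>N. \<Sum>a\<in>I. of_bool (j \<in> A a) * l a * q j)"
      by (simp add: l flip: sum_distrib_right)
    also have "\<dots> = (\<Sum>a\<in>I. l a * (\<Sum>j\<in>A a. q j))"
      by (subst sum.swap) (simp add: restrict sum_distrib_left mult_ac)
    also have "\<dots> \<le> (\<Sum>a\<in>I. l a * u i)"
    proof (intro sum_mono mult_left_mono)
      fix a assume a: "a \<in> I"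
      thus "(\<Sum>j\<in>A a. q j) \<le> u i"
        using u[OF i, of "A a"] A[OF a] internal_weight_eq_0_iff[OF M _ fin(1), of "A a"] by simp
    qed (use l0 in auto)
    also have "\<dots> \<le> card K * u i"
      using total u0[OF i] by (simp flip: sum_distrib_right add: mult_right_mono)
    finally show ?thesis .
  qed
  have "card K * (\<Sum>j\<in>N. q j) \<le> (\<Sum>i\<in>K. card K * u i)"
    using sum_mono[of K "\<lambda>_. \<Sum>j\<in>N. q j" "\<lambda>i. card K * u i"] average by simp
  hence lower: "(\<Sum>j\<in>N. q j) \<le> (\<Sum>i\<in>K. u i)"
    using fin(2) \<open>K \<noteq> {}\<close> by (simp add: card_gt_0_iff flip: sum_distrib_left)
  have "N = (\<Union>c\<in>choices K. P c)" and disj: "disjoint_family_on P (choices K)"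
    using part unfolding partitions_def by auto
  hence "(\<Sum>j\<in>N. q j) = (\<Sum>c\<in>choices K. \<Sum>j\<in>P c. q j)"
    using fin(2) finP
    by (simp only:) (rule sum.UNION_disjoint, auto simp: choices_def disjoint_family_on_def)
  also have "\<dots> = (\<Sum>j\<in>P None. q j) + (\<Sum>i\<in>K. \<Sum>j\<in>P (Some i). q j)"
    using fin(2) by (simp add: choices_def sum.reindex)
  \<comment> \<open>Idle workers have price 0. Once \<open>lower\<close> is applied, the
    \<open>q\<close>-sums over employed workers cancel, and only idle degrees and internal weights
    remain.\<close>
  also have "(\<Sum>j\<in>P None. q j) = (\<Sum>j\<in>P None. ?d j)"
    by (simp add: q_def p0)
  finally have "(\<Sum>j\<in>P None. ?d j) + (\<Sum>i\<in>K. internal_weight M (P (Some i))) \<le> 0"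
    using lower by (simp add: u_def sum_subtractf)
  moreover have d0: "0 \<le> ?d j" if "j \<in> N" for j
    using M that by (intro sum_nonneg) (auto simp: synergy_graph_def)
  moreover have i0: "0 \<le> internal_weight M (P (Some i))" if "i \<in> K" for i
    using internal_weight_nonneg[OF M sub[OF Some_in[OF that]]] .
  moreover have "0 \<le> (\<Sum>j\<in>P None. ?d j)"
    by (rule sum_nonneg) (use d0 sub[OF None_in] in blast)
  moreover have "0 \<le> (\<Sum>i\<in>K. internal_weight M (P (Some i)))"
    using i0 by (rule sum_nonneg)
  ultimately have zero: "(\<Sum>j\<in>P None. ?d j) = 0" "(\<Sum>i\<in>K. internal_weight M (P (Some i))) = 0"
    by linarith+
  have isolated: "M j j' = 0" if "j \<in> P None" "j' \<in> N" for j j'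
  proof -
    have jN: "j \<in> N" using that sub[OF None_in] by blast
    have "?d j = 0"
      using zero(1) d0 sub[OF None_in] finP[OF None_in] that(1)
      by (subst (asm) sum_nonneg_eq_0_iff) auto
    thus ?thesis
      using M jN that(2) fin(1)
      by (subst (asm) sum_nonneg_eq_0_iff) (auto simp: synergy_graph_def)
  qed
  have indep: "independent_in M (P (Some i))" if "i \<in> K" for i
    using zero(2) i0 fin(2) that internal_weight_eq_0_iff[OF M sub[OF Some_in[OF that]] fin(1)]
    by (subst (asm) sum_nonneg_eq_0_iff) auto
  obtain k where k: "k \<in> K" using \<open>K \<noteq> {}\<close> by blast
  \<comment> \<open>Employed workers are coloured by their firm; idle ones are isolated, so any
    colour \<open>k\<close> will do.\<close>
  define c where "c j = (if j \<in> P None then k else (SOME i. i \<in> K \<and> j \<in> P (Some i)))" for j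
  have c: "c j \<in> K \<and> j \<in> P (Some (c j))" if "j \<in> N" "j \<notin> P None" for j
  proof -
    have "\<exists>i. i \<in> K \<and> j \<in> P (Some i)"
      using that \<open>N = (\<Union>c\<in>choices K. P c)\<close> by (auto simp: choices_def)
    from someI_ex[OF this] show ?thesis using that(2) by (simp add: c_def)
  qed
  show ?thesis
  proof
    show "c ` N \<subseteq> K"
      using c k by (metis c_def image_subsetI)
  next
    fix j j' assume jj: "j \<in> N" "j' \<in> N" "j \<noteq> j'" "M j j' \<noteq> 0"
    have "M j' j \<noteq> 0" using M jj unfolding synergy_graph_def by metis
    hence "j \<notin> P None" "j' \<notin> P None" using isolated jj by blast+
    thus "c j \<noteq> c j'"
      using c jj indep unfolding independent_in_def by metis
  qed
qed

section \<open>The Groetzsch graph and its colourings\<close>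

text \<open>
  The Groetzsch graph as the Mycielskian of the pentagon: the pentagon is \<open>0,\<dots>,4\<close>, the copy of
  vertex \<open>i\<close> is \<open>5 + i\<close>, and the apex is \<open>10\<close>.
\<close>

definition groetzsch_arc :: "nat \<Rightarrow> nat \<Rightarrow> bool" where
  "groetzsch_arc a b \<longleftrightarrow>
     (a < 5 \<and> b = (a + 1) mod 5) \<or>
     (a < 5 \<and> (b = 5 + (a + 1) mod 5 \<or> b = 5 + (a + 4) mod 5)) \<or>
     (5 \<le> a \<and> a < 10 \<and> b = 10)"

definition groetzsch :: "nat \<Rightarrow> nat \<Rightarrow> real" where
  "groetzsch a b = (if groetzsch_arc a b \<or> groetzsch_arc b a then 1 else 0)"

lemma synergy_graph_groetzsch: "synergy_graph N groetzsch"
  by (auto simp: synergy_graph_def groetzsch_def)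

lemma lessThan_11: "{..<11::nat} = {0, 1, 2, 3, 4, 5, 6, 7, 8, 9, 10}"
  by auto presburger

lemma groetzsch_not_3_colourable:
  fixes c :: "nat \<Rightarrow> 'c"
  assumes "c ` {..<11} \<subseteq> K" "card K = 3"
  shows "\<exists>a<11. \<exists>b<11. a \<noteq> b \<and> groetzsch a b \<noteq> 0 \<and> c a = c b"
proof (rule ccontr)
  assume "\<not> ?thesis"
  hence proper: "c a \<noteq> c b" if "groetzsch_arc a b" "a < 11" "b < 11" "a \<noteq> b" for a b
    using that by (auto simp: groetzsch_def split: if_splits)
  have inK: "c a \<in> K" if "a < 11" for a using assms(1) that by auto
  text \<open>
    Mycielski's argument: giving the vertices coloured like the apex the colours of their copies
    leaves a colouring of the pentagon with the other two colours.
  \<close>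
  define h where "h i = (if c i = c 10 then c (5 + i) else c i)" for i
  have apex: "c (5 + i) \<noteq> c 10" if "i < 5" for i
    using that by (intro proper) (auto simp: groetzsch_arc_def)
  \<comment> \<open>Adjacent pentagon vertices cannot both have the apex colour, so \<open>h\<close>
    alters at most one of them; the copy whose colour it takes is adjacent to the other.\<close>
  have step: "h i \<noteq> h ((i + 1) mod 5)" if "i < 5" for i
  proof -
    have i: "i = 0 \<or> i = 1 \<or> i = 2 \<or> i = 3 \<or> i = 4" using that by linarith
    have "c i \<noteq> c ((i + 1) mod 5)" "c i \<noteq> c (5 + (i + 1) mod 5)" "c ((i + 1) mod 5) \<noteq> c (5 + i)"
      by (rule proper; use i in \<open>auto simp: groetzsch_arc_def\<close>)+
    thus ?thesis by (auto simp: h_def)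
  qed
  have "finite K" using assms(2) card.infinite by fastforce
  hence "card (K - {c 10}) = 2" using assms(2) inK[of 10] by simp
  then obtain x y where xy: "K - {c 10} = {x, y}"
    by (auto simp: card_2_iff)
  have "h i \<in> {x, y}" if "i < 5" for i
    using that apex[OF that] inK[of i] inK[of "5 + i"] unfolding xy[symmetric] h_def by auto
  \<comment> \<open>An odd cycle has no proper colouring with the two colours \<open>x\<close> and
    \<open>y\<close>.\<close>
  from this[of 0] this[of 1] this[of 2] this[of 3] this[of 4] show False
    using step[of 0] step[of 1] step[of 2] step[of 3] step[of 4] by (auto simp: numeral_2_eq_2)
qed

text \<open>An optimal fractional colouring, of total weight \<open>29/10\<close>.\<close>

definition stable :: "nat \<Rightarrow> nat set" where
  "stable a =
     (if a < 5 then {10, a, (a + 2) mod 5}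
      else if a < 10 then {a - 5, (a + 2) mod 5, a, 5 + (a + 2) mod 5}
      else {5, 6, 7, 8, 9})"

definition stable_weight :: "nat \<Rightarrow> real" where
  "stable_weight a = (if a < 5 then 1/5 else if a < 10 then 3/10 else 2/5)"

text \<open>Pentagon vertices two steps apart are not adjacent. They stay independent with the apex,
  which sees only copies, or with their own copies, which see only the apex and the pentagon
  neighbours of their originals.\<close>

lemma stable_independent:
  assumes "a < 11"
  shows "stable a \<subseteq> {..<11} \<and> independent_in groetzsch (stable a)"
proof -
  have "a \<in> {0, 1, 2, 3, 4, 5, 6, 7, 8, 9, 10}" using assms lessThan_11 by blast
  thus ?thesis
    by (elim insertE emptyE)
       (simp_all add: stable_def independent_in_def groetzsch_def groetzsch_arc_def)
qed

text \<open>A pentagon vertex lies in two sets of each of the first two kinds: 2/5 + 6/10. A copy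
  lies in two of the second kind and in the last set: 6/10 + 2/5. The apex lies in all five of the
  first kind.\<close>

lemma stable_cover:
  assumes "j < 11"
  shows "(\<Sum>a<11. of_bool (j \<in> stable a) * stable_weight a) = 1"
proof -
  have "j \<in> {0, 1, 2, 3, 4, 5, 6, 7, 8, 9, 10}" using assms lessThan_11 by blast
  thus ?thesis
    unfolding lessThan_11 by (auto simp: stable_def stable_weight_def)
qed

theorem proposition5p3:
  "\<exists>(N :: nat set) (K :: nat set) (v :: nat \<Rightarrow> nat set \<Rightarrow> real) (M :: nat \<Rightarrow> nat \<Rightarrow> real).
     competition_game N K v \<and> symmetric_game N K v \<and> card K = 3 \<and>
     synergy_graph N M \<and>
     (\<forall>i\<in>K. \<forall>S. S \<subseteq> N \<longrightarrow> v i S = synergy_value N M S) \<and>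
     \<not> (\<exists>P X. is_PSPE N K v P X)"
proof -
  let ?N = "{..<11::nat}" and ?K = "{..<3::nat}"
  have "\<not> is_PSPE ?N ?K (\<lambda>_. synergy_value ?N groetzsch) P X" for P X
  proof
    assume eq: "is_PSPE ?N ?K (\<lambda>_. synergy_value ?N groetzsch) P X"
    \<comment> \<open>The weights add up to 5 * 1/5 + 5 * 3/10 + 2/5 = 29/10.\<close>
    have total: "(\<Sum>a<11. stable_weight a) \<le> card ?K"
      unfolding lessThan_11 by (simp add: stable_weight_def)
    obtain c where "c ` ?N \<subseteq> ?K"
      and "\<And>j j'. j \<in> ?N \<Longrightarrow> j' \<in> ?N \<Longrightarrow> j \<noteq> j' \<Longrightarrow> groetzsch j j' \<noteq> 0 \<Longrightarrow> c j \<noteq> c j'"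
    proof (rule PSPE_imp_colouring[OF _ _ _ _ synergy_graph_groetzsch _ _ _ total eq])
      show "stable a \<subseteq> ?N \<and> independent_in groetzsch (stable a)" if "a \<in> {..<11}" for a
        using that by (intro stable_independent) simp
      show "(\<Sum>a<11. of_bool (j \<in> stable a) * stable_weight a) = 1" if "j \<in> ?N" for j
        using that by (intro stable_cover) simp
      show "0 \<le> stable_weight a" for a
        by (simp add: stable_weight_def)
      show "?K \<noteq> {}"
        by (simp add: lessThan_empty_iff)
    qed auto
    thus False
      using groetzsch_not_3_colourable[of c ?K] by auto
  qed
  moreover have "competition_game ?N ?K (\<lambda>_. synergy_value ?N groetzsch)"
    by (rule synergy_competition_game[OF synergy_graph_groetzsch]) auto
  ultimately show ?thesis
    by (intro exI[of _ ?N] exI[of _ ?K] exI[of _ "\<lambda>_. synergy_value ?N groetzsch"]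
        exI[of _ groetzsch])
       (auto simp: symmetric_game_def synergy_graph_groetzsch)
qed

end
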